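(* Let $\omega$ be the set of non-negative integers and let $(H_\lambda)_{\lambda\in\omega}$ be a family of commutative cancellative monoids such that for every $\lambda\in\omega$ the following holds: every finite multiset $L\subseteq\mathbb N_{\ge2}$ is the multiset of lengths of some element of $H_\lambda$. Let $\mathcal U$ be a non-principal ultrafilter on $\omega$ and let $H^*=\prod^{\mathcal U}_{\lambda\in\omega}H_\lambda$ be the ultraproduct. Then for every multiset $L\subseteq\mathbb N_{\ge2}$ there exists $r^*\in H^*$ whose multiset of lengths is $L$ in the sense that for all $\ell\in\mathbb N_{\ge2}$: (i) $\#_{L(r^* )}(\ell)=\#_L(\ell)$ if $\#_L(\ell)<\infty$, and (ii) $\#_{L(r^* )}(\ell)=\infty$ if and only if $\#_L(\ell)=\infty$.
   Context: A multiset $L\subseteq\mathbb N_{\ge2}$ assigns to each integer $\ell\ge2$ a cardinal $\#_L(\ell)$, its multiplicity (and multiplicity $0$ to every other integer). It is finite if only finitely many $\ell$ have non-zero multiplicity and all multiplicities are finite. One writes $\#_L(\ell)=\infty$ if and only if $\#_L(\ell)$ is an infinite cardinal. For a commutative cancellative monoid $M$ (written multiplicatively), $M^\times$ is its group of units. An atom of $M$ is a non-unit $a$ such that $a=bc$ with $b,c\in M$ implies $b\in M^\times$ or $c\in M^\times$. Elements $a,b$ are associated if $a=\varepsilon b$ for some $\varepsilon\in M^\times$. A factorization of $a\in M$ of length $\ell\in\mathbb N_0$ is an expression $a=u_1\cdots u_\ell$ with atoms $u_i$ (for a unit $a$, the empty factorization of length $0$ is allowed: factorizations are considered up to units). Two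 factorizations $u_1\cdots u_n$ and $v_1\cdots v_m$ are essentially the same if $n=m$ and, for some permutation $\sigma$, $u_i$ is associated to $v_{\sigma(i)}$ for all $i$. The multiset of lengths $L(a)$ of $a\in M$ is the multiset of non-negative integers in which $\#_{L(a)}(\ell)$ is the cardinality of the set of classes, modulo being essentially the same, of factorizations of $a$ of length $\ell$. The ultraproduct $H^*$ is the quotient of $\prod_\lambda H_\lambda$ by the relation $r\equiv s\iff\{\lambda\mid r_\lambda=s_\lambda\}\in\mathcal U$, with componentwise multiplication; it is again a commutative cancellative monoid, and $r^*$ denotes the class of $r$. *)

theory Defs
  imports "HOL-Algebra.Divisibility" "HOL-Algebra.Product_Groups"
begin

unbundle cardinal_syntax

section \<open>Multisets with cardinal multiplicities\<close>

text \<open>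
  A multiset \<open>L\<close> of natural numbers is the function sending \<open>l\<close> to its multiplicity in \<open>L\<close>. A
  multiplicity is an arbitrary cardinal, i.e. a relation satisfying \<^const>\<open>Card_order\<close>, so equality
  of multiplicities is \<open>=o\<close>, also across different underlying types.
\<close>

type_synonym 'k cmultiset = "nat \<Rightarrow> 'k rel"

definition multiset_ge2 :: "'k cmultiset \<Rightarrow> bool" where
  "multiset_ge2 L \<longleftrightarrow>
     (\<forall>l. Card_order (L l)) \<and> (\<forall>l. l < 2 \<longrightarrow> L l =o (czero :: 'k rel))"

definition finite_cmultiset :: "'k cmultiset \<Rightarrow> bool" where
  "finite_cmultiset L \<longleftrightarrow>
     finite {l. \<not> L l =o (czero :: 'k rel)} \<and> (\<forall>l. \<not> cinfinite (L l))"

section \<open>Multisets of lengths\<close>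

text \<open>
  In a commutative cancellative monoid, \<^const>\<open>irreducible\<close>, \<^const>\<open>associated\<close> and
  \<^const>\<open>essentially_equal\<close> have the following elementary descriptions.
\<close>

lemma (in comm_monoid_cancel) irreducible_iff_atom:
  assumes "a \<in> carrier G"
  shows "irreducible G a \<longleftrightarrow> a \<notin> Units G \<and>
    (\<forall>b\<in>carrier G. \<forall>c\<in>carrier G. a = b \<otimes> c \<longrightarrow> b \<in> Units G \<or> c \<in> Units G)"
    (is "_ \<longleftrightarrow> ?atom")
proof
  assume irr: "irreducible G a"
  have "b \<in> Units G \<or> c \<in> Units G" if "b \<in> carrier G" "c \<in> carrier G" "a = b \<otimes> c" for b c
    using irreducible_prodE[of b c] irr that by blast
  with irr show ?atom
    unfolding irreducible_def by blast
next
  assume atom: ?atom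
  show "irreducible G a"
  proof (rule irreducibleI)
    show "a \<notin> Units G" using atom by blast
  next
    fix b assume b: "b \<in> carrier G" and pf: "properfactor G b a"
    then obtain c where c: "c \<in> carrier G" "a = b \<otimes> c"
      unfolding properfactor_def factor_def by blast
    have "c \<notin> Units G"
    proof
      assume u: "c \<in> Units G"
      have "b = a \<otimes> inv c"
        using c b u by (simp add: m_assoc Units_r_inv)
      then have "a divides b"
        unfolding factor_def using u by blast
      with pf show False
        unfolding properfactor_def by blast
    qed
    with atom b c show "b \<in> Units G" by blast
  qed
qed

lemma (in comm_monoid_cancel) associated_iff_unit_mult:
  assumes "a \<in> carrier G" "b \<in> carrier G"
  shows "a \<sim> b \<longleftrightarrow> (\<exists>e\<in>Units G. a = e \<otimes> b)"
  using assms by (metis associated_iff m_comm Units_closed)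

lemma essentially_equal_iff_permutation:
  "essentially_equal G us vs \<longleftrightarrow> length us = length vs \<and>
    (\<exists>\<sigma>. \<sigma> permutes {..<length us} \<and> (\<forall>i<length us. us ! \<sigma> i \<sim>\<^bsub>G\<^esub> vs ! i))"
proof
  assume "essentially_equal G us vs"
  then obtain ws where ws: "mset us = mset ws" "list_all2 (\<sim>\<^bsub>G\<^esub>) ws vs"
    unfolding essentially_equal_def by blast
  then obtain \<sigma> where \<sigma>: "\<sigma> permutes {..<length us}" "permute_list \<sigma> us = ws"
    using mset_eq_permutation by metis
  from ws(1) have "length us = length ws" by (rule mset_eq_length)
  with ws(2) \<sigma> show "length us = length vs \<and>
    (\<exists>\<sigma>. \<sigma> permutes {..<length us} \<and> (\<forall>i<length us. us ! \<sigma> i \<sim>\<^bsub>G\<^esub> vs ! i))"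
    by (metis list_all2_conv_all_nth permute_list_nth)
next
  assume "length us = length vs \<and>
    (\<exists>\<sigma>. \<sigma> permutes {..<length us} \<and> (\<forall>i<length us. us ! \<sigma> i \<sim>\<^bsub>G\<^esub> vs ! i))"
  then obtain \<sigma> where "length us = length vs" "\<sigma> permutes {..<length us}"
    "\<forall>i<length us. us ! \<sigma> i \<sim>\<^bsub>G\<^esub> vs ! i" by blast
  then have "mset us = mset (permute_list \<sigma> us)" "list_all2 (\<sim>\<^bsub>G\<^esub>) (permute_list \<sigma> us) vs"
    by (auto simp: list_all2_conv_all_nth permute_list_nth)
  then show "essentially_equal G us vs"
    unfolding essentially_equal_def by blast
qed

text \<open>
  The product of the atoms is \<open>a\<close> itself, but for any unit \<open>a\<close> the empty list is admitted as well.
\<close>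

definition factorizations :: "('a, 'b) monoid_scheme \<Rightarrow> 'a \<Rightarrow> nat \<Rightarrow> 'a list set" where
  "factorizations M a l =
     {us. set us \<subseteq> carrier M \<and> length us = l \<and>
          (factors M us a \<or> us = [] \<and> a \<in> Units M)}"

definition ess_same :: "('a, 'b) monoid_scheme \<Rightarrow> 'a \<Rightarrow> nat \<Rightarrow> 'a list rel" where
  "ess_same M a l =
     {(us, vs). us \<in> factorizations M a l \<and> vs \<in> factorizations M a l \<and> essentially_equal M us vs}"

definition multiset_of_lengths :: "('a, 'b) monoid_scheme \<Rightarrow> 'a \<Rightarrow> 'a list set cmultiset" where
  "multiset_of_lengths M a l = |factorizations M a l // ess_same M a l|"

lemma (in comm_monoid_cancel) equiv_ess_same: "equiv (factorizations G a l) (ess_same G a l)"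
proof (rule equivI)
  show "ess_same G a l \<subseteq> factorizations G a l \<times> factorizations G a l"
    unfolding ess_same_def by blast
  show "refl_on (factorizations G a l) (ess_same G a l)"
    unfolding ess_same_def refl_on_def factorizations_def by auto
  show "sym (ess_same G a l)"
    unfolding ess_same_def factorizations_def by (auto intro!: symI intro: ee_sym)
  show "trans (ess_same G a l)"
    unfolding ess_same_def factorizations_def by (auto intro!: transI intro: ee_trans)
qed

section \<open>Ultraproducts\<close>

definition ultrafilter :: "'i filter \<Rightarrow> bool" where
  "ultrafilter U \<longleftrightarrow> U \<noteq> bot \<and> (\<forall>P. eventually P U \<or> eventually (\<lambda>i. \<not> P i) U)"

definition nonprincipal :: "'i filter \<Rightarrow> bool" where
  "nonprincipal U \<longleftrightarrow> (\<forall>i. U \<noteq> principal {i})"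

text \<open>
  Despite its name, \<^const>\<open>product_group\<close> is the direct product of arbitrary monoids.
\<close>

definition ultra_rel :: "'i filter \<Rightarrow> ('i \<Rightarrow> ('a, 'b) monoid_scheme) \<Rightarrow> ('i \<Rightarrow> 'a) rel" where
  "ultra_rel U H =
     {(r, s). r \<in> carrier (product_group UNIV H) \<and> s \<in> carrier (product_group UNIV H) \<and>
              eventually (\<lambda>i. r i = s i) U}"

definition ultraproduct ::
    "'i filter \<Rightarrow> ('i \<Rightarrow> ('a, 'b) monoid_scheme) \<Rightarrow> ('i \<Rightarrow> 'a) set monoid" where
  "ultraproduct U H =
     \<lparr>carrier = carrier (product_group UNIV H) // ultra_rel U H,
      monoid.mult = (\<lambda>X Y. \<Union>r\<in>X. \<Union>s\<in>Y. ultra_rel U H `` {r \<otimes>\<^bsub>product_group UNIV H\<^esub> s}),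
      one = ultra_rel U H `` {\<one>\<^bsub>product_group UNIV H\<^esub>}\<rparr>"

lemma equiv_ultra_rel: "equiv (carrier (product_group UNIV H)) (ultra_rel U H)"
proof (rule equivI)
  show "ultra_rel U H \<subseteq> carrier (product_group UNIV H) \<times> carrier (product_group UNIV H)"
    unfolding ultra_rel_def by blast
  show "refl_on (carrier (product_group UNIV H)) (ultra_rel U H)"
    unfolding ultra_rel_def refl_on_def by auto
  show "sym (ultra_rel U H)"
    unfolding ultra_rel_def by (auto intro!: symI elim: eventually_mono)
  show "trans (ultra_rel U H)"
    unfolding ultra_rel_def by (auto intro!: transI elim: eventually_elim2)
qed

lemma mult_ultraproduct:
  fixes H :: "'i \<Rightarrow> ('a, 'b) monoid_scheme"
  assumes H: "\<And>i. monoid (H i)"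
    and r: "r \<in> carrier (product_group UNIV H)" and s: "s \<in> carrier (product_group UNIV H)"
  shows "ultra_rel U H `` {r} \<otimes>\<^bsub>ultraproduct U H\<^esub> ultra_rel U H `` {s} =
         ultra_rel U H `` {\<lambda>i. r i \<otimes>\<^bsub>H i\<^esub> s i}"
proof -
  have "congruent2 (ultra_rel U H) (ultra_rel U H)
      (\<lambda>r s. ultra_rel U H `` {r \<otimes>\<^bsub>product_group UNIV H\<^esub> s})"
  proof (rule congruent2I')
    fix r r' s s' assume rs: "(r, r') \<in> ultra_rel U H" "(s, s') \<in> ultra_rel U H"
    then have "eventually (\<lambda>i. r i \<otimes>\<^bsub>H i\<^esub> s i = r' i \<otimes>\<^bsub>H i\<^esub> s' i) U"
      unfolding ultra_rel_def by (auto elim: eventually_elim2)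
    with rs have "(r \<otimes>\<^bsub>product_group UNIV H\<^esub> s, r' \<otimes>\<^bsub>product_group UNIV H\<^esub> s') \<in> ultra_rel U H"
      unfolding ultra_rel_def by (auto simp: PiE_iff intro!: monoid.m_closed[OF H])
    then show "ultra_rel U H `` {r \<otimes>\<^bsub>product_group UNIV H\<^esub> s} =
        ultra_rel U H `` {r' \<otimes>\<^bsub>product_group UNIV H\<^esub> s'}"
      by (rule equiv_class_eq[OF equiv_ultra_rel])
  qed
  from UN_equiv_class2[OF equiv_ultra_rel equiv_ultra_rel this r s] show ?thesis
    by (simp add: ultraproduct_def restrict_def)
qed

lemma comm_monoid_cancel_ultraproduct:
  fixes H :: "'i \<Rightarrow> ('a, 'b) monoid_scheme"
  assumes H: "\<And>i. comm_monoid_cancel (H i)"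
  shows "comm_monoid_cancel (ultraproduct U H)"
proof -
  let ?P = "product_group UNIV H" and ?R = "ultra_rel U H" and ?M = "ultraproduct U H"
  have cm: "\<And>i. comm_monoid (H i)" and mon: "\<And>i. monoid (H i)"
    using H comm_monoid_cancel_def comm_monoid_def by blast+
  have carr: "\<And>X. X \<in> carrier ?M \<longleftrightarrow> (\<exists>r\<in>carrier ?P. X = ?R `` {r})"
    by (auto simp: ultraproduct_def quotient_def)
  have one: "\<one>\<^bsub>?M\<^esub> = ?R `` {\<lambda>i. \<one>\<^bsub>H i\<^esub>}"
    by (simp add: ultraproduct_def restrict_def)
  have oneP: "(\<lambda>i. \<one>\<^bsub>H i\<^esub>) \<in> carrier ?P"
    by (simp add: PiE_iff monoid.one_closed[OF mon])
  have multP: "(\<lambda>i. r i \<otimes>\<^bsub>H i\<^esub> s i) \<in> carrier ?P" if "r \<in> carrier ?P" "s \<in> carrier ?P" for r s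
    using that by (simp add: PiE_iff monoid.m_closed[OF mon])
  note mult = mult_ultraproduct[OF mon]
  have mem: "\<And>r i. r \<in> carrier ?P \<Longrightarrow> r i \<in> carrier (H i)"
    by (simp add: PiE_iff)
  show ?thesis
  proof (rule comm_monoid_cancelI)
    show "comm_monoid ?M"
    proof (rule comm_monoidI)
      fix x y assume "x \<in> carrier ?M" "y \<in> carrier ?M"
      then obtain r s where *: "r \<in> carrier ?P" "s \<in> carrier ?P" "x = ?R `` {r}" "y = ?R `` {s}"
        unfolding carr by blast
      show "x \<otimes>\<^bsub>?M\<^esub> y \<in> carrier ?M"
        unfolding *(3,4) mult[OF *(1,2)] carr using multP[OF *(1,2)] by blast
    next
      show "\<one>\<^bsub>?M\<^esub> \<in> carrier ?M"
        using carr one oneP by blast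
    next
      fix x y z assume "x \<in> carrier ?M" "y \<in> carrier ?M" "z \<in> carrier ?M"
      then obtain r s t where *: "r \<in> carrier ?P" "s \<in> carrier ?P" "t \<in> carrier ?P"
        "x = ?R `` {r}" "y = ?R `` {s}" "z = ?R `` {t}"
        unfolding carr by blast
      show "x \<otimes>\<^bsub>?M\<^esub> y \<otimes>\<^bsub>?M\<^esub> z = x \<otimes>\<^bsub>?M\<^esub> (y \<otimes>\<^bsub>?M\<^esub> z)"
        unfolding *(4-6) using *(1-3) mem
        by (simp only: mult multP monoid.m_assoc[OF mon])
    next
      fix x assume "x \<in> carrier ?M"
      then obtain r where *: "r \<in> carrier ?P" "x = ?R `` {r}"
        unfolding carr by blast
      show "\<one>\<^bsub>?M\<^esub> \<otimes>\<^bsub>?M\<^esub> x = x"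
        unfolding one *(2) using *(1) mem
        by (simp only: mult oneP monoid.l_one[OF mon])
    next
      fix x y assume "x \<in> carrier ?M" "y \<in> carrier ?M"
      then obtain r s where *: "r \<in> carrier ?P" "s \<in> carrier ?P" "x = ?R `` {r}" "y = ?R `` {s}"
        unfolding carr by blast
      have "(\<lambda>i. r i \<otimes>\<^bsub>H i\<^esub> s i) = (\<lambda>i. s i \<otimes>\<^bsub>H i\<^esub> r i)"
        using *(1,2) mem by (intro ext comm_monoid.m_comm[OF cm])
      then show "x \<otimes>\<^bsub>?M\<^esub> y = y \<otimes>\<^bsub>?M\<^esub> x"
        unfolding *(3,4) using *(1,2) by (simp only: mult)
    qed
  next
    fix x y z
    assume eq: "x \<otimes>\<^bsub>?M\<^esub> z = y \<otimes>\<^bsub>?M\<^esub> z"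
      and "x \<in> carrier ?M" "y \<in> carrier ?M" "z \<in> carrier ?M"
    then obtain r s t where *: "r \<in> carrier ?P" "s \<in> carrier ?P" "t \<in> carrier ?P"
      "x = ?R `` {r}" "y = ?R `` {s}" "z = ?R `` {t}"
      unfolding carr by blast
    from eq have "(\<lambda>i. r i \<otimes>\<^bsub>H i\<^esub> t i, \<lambda>i. s i \<otimes>\<^bsub>H i\<^esub> t i) \<in> ?R"
      unfolding *(4-6) using *(1-3)
      by (simp only: mult multP eq_equiv_class_iff[OF equiv_ultra_rel])
    then have "eventually (\<lambda>i. r i \<otimes>\<^bsub>H i\<^esub> t i = s i \<otimes>\<^bsub>H i\<^esub> t i) U"
      by (simp add: ultra_rel_def)
    then have "eventually (\<lambda>i. r i = s i) U"
      by (rule eventually_mono)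
        (metis *(1-3) mem H comm_monoid_cancel.axioms(1) monoid_cancel.r_cancel)
    then have "(r, s) \<in> ?R"
      using *(1,2) by (simp add: ultra_rel_def)
    then show "x = y"
      unfolding *(4,5) by (rule equiv_class_eq[OF equiv_ultra_rel])
  qed
qed

end

theory Submission
  imports Defs
begin

text \<open>
  Having at least \<open>n\<close> essentially different factorizations of length \<open>l\<close> is a first-order property of
  an element, so by Los's theorem it passes between \<open>H\<^sup>*\<close> and almost all \<open>H\<^sub>\<lambda>\<close>. Truncate \<open>L\<close> to
  finite multisets \<open>L\<^sub>\<lambda>\<close> by keeping only lengths \<open>l \<le> \<lambda>\<close> and replacing infinite multiplicities
  by \<open>\<lambda>\<close>, and let \<open>r\<^sub>\<lambda>\<close> realize \<open>L\<^sub>\<lambda>\<close>. As \<open>\<U>\<close> contains all cofinite sets, the class of \<open>r\<close> has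
  exactly \<open>n\<close> factorizations of length \<open>l\<close> if \<open>L l\<close> is the finite number \<open>n\<close>, and at least \<open>n\<close>
  for every \<open>n\<close> if \<open>L l\<close> is infinite.
\<close>

section \<open>Ultrafilters\<close>

lemma eventually_not_ultrafilter:
  assumes "ultrafilter U"
  shows "eventually (\<lambda>i. \<not> P i) U \<longleftrightarrow> \<not> eventually P U"
proof -
  have "False" if "eventually P U" "eventually (\<lambda>i. \<not> P i) U"
    using eventually_conj[OF that] assms by (auto simp: ultrafilter_def)
  with assms show ?thesis
    unfolding ultrafilter_def by blast
qed

text \<open>Dual to closure of a filter under finite intersections, since an ultrafilter decides
  complements. Finiteness of \<open>S\<close> matters: for infinite \<open>S\<close> the equivalence
  can fail.\<close>

lemma eventually_bex_ultrafilter: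
  assumes U: "ultrafilter U" and "finite S"
  shows "eventually (\<lambda>i. \<exists>s\<in>S. P s i) U \<longleftrightarrow> (\<exists>s\<in>S. eventually (P s) U)"
proof -
  have "\<not> eventually (\<lambda>i. \<exists>s\<in>S. P s i) U \<longleftrightarrow> eventually (\<lambda>i. \<forall>s\<in>S. \<not> P s i) U"
    unfolding eventually_not_ultrafilter[OF U, symmetric] by simp
  also have "\<dots> \<longleftrightarrow> (\<forall>s\<in>S. \<not> eventually (P s) U)"
    using \<open>finite S\<close> by (simp add: eventually_ball_finite_distrib eventually_not_ultrafilter[OF U])
  finally show ?thesis by blast
qed

lemma eventually_disj_ultrafilter:
  assumes "ultrafilter U"
  shows "eventually (\<lambda>i. P i \<or> Q i) U \<longleftrightarrow> eventually P U \<or> eventually Q U"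
  using eventually_bex_ultrafilter[OF assms, of "{False, True}" "\<lambda>b. if b then Q else P"]
  by (simp add: ex_bool_eq)

text \<open>If the tail from \<open>k\<close> on were not in \<open>U\<close>, its finite complement
  would be, hence some singleton \<open>{j}\<close>, and \<open>U\<close> would be principal at
  \<open>j\<close>.\<close>

lemma eventually_ge_nonprincipal:
  fixes U :: "nat filter"
  assumes U: "ultrafilter U" and np: "nonprincipal U"
  shows "eventually (\<lambda>i. k \<le> i) U"
proof (rule ccontr)
  assume "\<not> eventually (\<lambda>i. k \<le> i) U"
  then have "eventually (\<lambda>i. \<exists>j\<in>{..<k}. i = j) U"
    unfolding eventually_not_ultrafilter[OF U, symmetric] by (simp add: not_le)
  then obtain j where j: "eventually (\<lambda>i. i = j) U"
    unfolding eventually_bex_ultrafilter[OF U finite_lessThan] by blast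
  have "eventually P U \<longleftrightarrow> P j" for P
  proof
    assume "eventually P U"
    with j have "eventually (\<lambda>i. P j) U"
      by eventually_elim auto
    with U show "P j"
      by (auto simp: ultrafilter_def)
  next
    assume "P j"
    with j show "eventually P U"
      by (auto elim: eventually_mono)
  qed
  then have "U = principal {j}"
    by (simp add: filter_eq_iff eventually_principal)
  with np show False
    by (simp add: nonprincipal_def)
qed

section \<open>Los's theorem for factorizations\<close>

text \<open>Counts are transferred through such thresholds, because a lower bound \<open>n\<close>
  is first-order while a possibly infinite cardinal is not. Pairs \<open>k' < k\<close> suffice
  since essential equality is symmetric in the monoids considered.\<close>

definition many_factorizations :: "('a, 'b) monoid_scheme \<Rightarrow> 'a \<Rightarrow> nat \<Rightarrow> nat \<Rightarrow> bool" where
  "many_factorizations M a l n \<longleftrightarrow>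
     (\<exists>f. (\<forall>k<n. f k \<in> factorizations M a l) \<and>
          (\<forall>k<n. \<forall>k'<k. \<not> essentially_equal M (f k) (f k')))"

text \<open>Pairwise inequivalent members of \<open>A\<close> are representatives of distinct
  classes. The infinite case is a separate disjunct because \<open>card\<close> is 0 on infinite
  sets.\<close>

lemma equiv_quotient_at_least_iff:
  assumes R: "equiv A R"
  shows "(\<exists>f. (\<forall>k<n. f k \<in> A) \<and> (\<forall>k<n. \<forall>k'<k. (f k, f k') \<notin> R)) \<longleftrightarrow>
    infinite (A // R) \<or> n \<le> card (A // R)"
proof
  assume "\<exists>f. (\<forall>k<n. f k \<in> A) \<and> (\<forall>k<n. \<forall>k'<k. (f k, f k') \<notin> R)"
  then obtain f where f: "\<And>k. k < n \<Longrightarrow> f k \<in> A" "\<And>k k'. k < n \<Longrightarrow> k' < k \<Longrightarrow> (f k, f k') \<notin> R"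
    by blast
  have "inj_on (\<lambda>k. R `` {f k}) {..<n}"
  proof (rule linorder_inj_onI)
    fix k k' assume "k < k'" "k \<in> {..<n}" "k' \<in> {..<n}"
    with f show "R `` {f k} \<noteq> R `` {f k'}"
      using eq_equiv_class_iff[OF R] by (metis lessThan_iff)
  qed auto
  moreover have "(\<lambda>k. R `` {f k}) ` {..<n} \<subseteq> A // R"
    using f by (auto intro: quotientI)
  ultimately show "infinite (A // R) \<or> n \<le> card (A // R)"
    using card_inj_on_le by fastforce
next
  assume "infinite (A // R) \<or> n \<le> card (A // R)"
  then obtain B where B: "B \<subseteq> A // R" "finite B" "card B = n"
    by (meson infinite_arbitrarily_large obtain_subset_with_card_n)
  then obtain h where h: "bij_betw h {..<n} B"
    using ex_bij_betw_nat_finite[of B] by (auto simp: atLeast0LessThan)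
  have "\<exists>x\<in>A. h k = R `` {x}" if "k < n" for k
    using h B that by (meson bij_betwE lessThan_iff quotientE subsetD)
  then obtain f where f: "\<And>k. k < n \<Longrightarrow> f k \<in> A" "\<And>k. k < n \<Longrightarrow> h k = R `` {f k}"
    by metis
  have "(f k, f k') \<notin> R" if "k < n" "k' < k" for k k'
  proof
    assume "(f k, f k') \<in> R"
    then have "h k = h k'"
      using f that equiv_class_eq[OF R] by simp
    with h that show False
      using inj_onD[of h "{..<n}" k k'] by (auto simp: bij_betw_def)
  qed
  with f show "\<exists>f. (\<forall>k<n. f k \<in> A) \<and> (\<forall>k<n. \<forall>k'<k. (f k, f k') \<notin> R)"
    by blast
qed

lemma (in comm_monoid_cancel) many_factorizations_iff:
  "many_factorizations G a l n \<longleftrightarrow>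
     infinite (factorizations G a l // ess_same G a l) \<or>
     n \<le> card (factorizations G a l // ess_same G a l)"
proof -
  have "many_factorizations G a l n \<longleftrightarrow>
    (\<exists>f. (\<forall>k<n. f k \<in> factorizations G a l) \<and> (\<forall>k<n. \<forall>k'<k. (f k, f k') \<notin> ess_same G a l))"
    unfolding many_factorizations_def ess_same_def
    by (intro ex_cong1 conj_cong refl) (auto dest: less_trans)
  then show ?thesis
    by (simp only: equiv_quotient_at_least_iff[OF equiv_ess_same])
qed

section \<open>Families and their classes in the ultraproduct\<close>

locale ultraproduct_monoids =
  fixes U :: "'i filter" and H :: "'i \<Rightarrow> ('a, 'b) monoid_scheme"
  assumes U: "ultrafilter U" and H: "\<And>i. comm_monoid_cancel (H i)"
begin

abbreviation "M \<equiv> ultraproduct U H"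

abbreviation "cls x \<equiv> ultra_rel U H `` {x}"

text \<open>The carrier of the direct product without \<open>PiE\<close>: over the index set
  \<open>UNIV\<close>, extensionality imposes no condition.\<close>

definition "Fam = {x. \<forall>i. x i \<in> carrier (H i)}"

lemma monoid_H: "monoid (H i)"
  using H comm_monoid_cancel_def comm_monoid_def by blast

sublocale M: comm_monoid_cancel M
  by (rule comm_monoid_cancel_ultraproduct) (rule H)

lemma carrier_product: "carrier (product_group UNIV H) = Fam"
  by (auto simp: Fam_def PiE_iff)

lemma carrier_M: "carrier M = cls ` Fam"
  unfolding ultraproduct_def quotient_def carrier_product by auto

lemma cls_eq_iff: "x \<in> Fam \<Longrightarrow> y \<in> Fam \<Longrightarrow> cls x = cls y \<longleftrightarrow> eventually (\<lambda>i. x i = y i) U"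
  unfolding carrier_product[symmetric]
  by (subst eq_equiv_class_iff[OF equiv_ultra_rel]) (auto simp: ultra_rel_def)

lemma one_Fam: "(\<lambda>i. \<one>\<^bsub>H i\<^esub>) \<in> Fam"
  by (simp add: Fam_def monoid.one_closed[OF monoid_H])

lemma one_M: "\<one>\<^bsub>M\<^esub> = cls (\<lambda>i. \<one>\<^bsub>H i\<^esub>)"
  by (simp add: ultraproduct_def restrict_def)

lemma mult_Fam: "x \<in> Fam \<Longrightarrow> y \<in> Fam \<Longrightarrow> (\<lambda>i. x i \<otimes>\<^bsub>H i\<^esub> y i) \<in> Fam"
  by (simp add: Fam_def monoid.m_closed[OF monoid_H])

lemma mult_M: "x \<in> Fam \<Longrightarrow> y \<in> Fam \<Longrightarrow> cls x \<otimes>\<^bsub>M\<^esub> cls y = cls (\<lambda>i. x i \<otimes>\<^bsub>H i\<^esub> y i)"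
  unfolding carrier_product[symmetric] by (rule mult_ultraproduct[OF monoid_H])

section \<open>Transfer of existential quantifiers, units, atoms and associates\<close>

lemma eventually_bex_carrier:
  "eventually (\<lambda>i. \<exists>b\<in>carrier (H i). Q i b) U \<longleftrightarrow> (\<exists>b\<in>Fam. eventually (\<lambda>i. Q i (b i)) U)"
proof
  assume ev: "eventually (\<lambda>i. \<exists>b\<in>carrier (H i). Q i b) U"
  \<comment> \<open>Where no witness exists the identity element serves as default, so that the
    choice yields a family in \<open>Fam\<close>.\<close>
  have "\<exists>b\<in>carrier (H i). (\<exists>b\<in>carrier (H i). Q i b) \<longrightarrow> Q i b" for i
    using monoid.one_closed[OF monoid_H[of i]] by blast
  then obtain b where b: "b i \<in> carrier (H i)" "(\<exists>b\<in>carrier (H i). Q i b) \<longrightarrow> Q i (b i)" for i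
    by metis
  from ev have "eventually (\<lambda>i. Q i (b i)) U"
    by (rule eventually_mono) (use b(2) in blast)
  with b(1) show "\<exists>b\<in>Fam. eventually (\<lambda>i. Q i (b i)) U"
    unfolding Fam_def by blast
next
  assume "\<exists>b\<in>Fam. eventually (\<lambda>i. Q i (b i)) U"
  then obtain b where "b \<in> Fam" "eventually (\<lambda>i. Q i (b i)) U"
    by blast
  then show "eventually (\<lambda>i. \<exists>b\<in>carrier (H i). Q i b) U"
    unfolding Fam_def by (auto elim!: eventually_mono)
qed

text \<open>By commutativity a one-sided inverse suffices, so being a unit is one existential
  quantifier over an equation.\<close>

lemma Units_M_iff:
  assumes x: "x \<in> Fam"
  shows "cls x \<in> Units M \<longleftrightarrow> eventually (\<lambda>i. x i \<in> Units (H i)) U"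
proof -
  have "x i \<in> Units (H i) \<longleftrightarrow> (\<exists>y\<in>carrier (H i). x i \<otimes>\<^bsub>H i\<^esub> y = \<one>\<^bsub>H i\<^esub>)" for i
    using x comm_monoid.m_comm[OF comm_monoid_cancel.axioms(2)[OF H[of i]]]
    unfolding Units_def Fam_def by auto
  then have "eventually (\<lambda>i. x i \<in> Units (H i)) U \<longleftrightarrow>
      (\<exists>y\<in>Fam. eventually (\<lambda>i. x i \<otimes>\<^bsub>H i\<^esub> y i = \<one>\<^bsub>H i\<^esub>) U)"
    by (simp add: eventually_bex_carrier)
  also have "\<dots> \<longleftrightarrow> (\<exists>y\<in>Fam. cls x \<otimes>\<^bsub>M\<^esub> cls y = \<one>\<^bsub>M\<^esub>)"
    using x by (intro bex_cong refl) (simp add: mult_M one_M cls_eq_iff mult_Fam one_Fam)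
  also have "\<dots> \<longleftrightarrow> cls x \<in> Units M"
    using x M.m_comm unfolding Units_def carrier_M by auto
  finally show ?thesis by simp
qed

text \<open>The negation is transferred: its quantifiers are existential, as
  \<open>eventually_bex_carrier\<close> requires, and the ultrafilter commutes with the remaining
  connectives.\<close>

lemma irreducible_M_iff:
  assumes x: "x \<in> Fam"
  shows "irreducible M (cls x) \<longleftrightarrow> eventually (\<lambda>i. irreducible (H i) (x i)) U"
proof -
  have "\<not> irreducible (H i) (x i) \<longleftrightarrow> x i \<in> Units (H i) \<or>
      (\<exists>b\<in>carrier (H i). \<exists>c\<in>carrier (H i).
        x i = b \<otimes>\<^bsub>H i\<^esub> c \<and> b \<notin> Units (H i) \<and> c \<notin> Units (H i))" for i
    using x by (subst comm_monoid_cancel.irreducible_iff_atom[OF H]) (auto simp: Fam_def)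
  then have "\<not> eventually (\<lambda>i. irreducible (H i) (x i)) U \<longleftrightarrow>
      eventually (\<lambda>i. x i \<in> Units (H i)) U \<or>
      (\<exists>b\<in>Fam. \<exists>c\<in>Fam. eventually (\<lambda>i. x i = b i \<otimes>\<^bsub>H i\<^esub> c i) U \<and>
        \<not> eventually (\<lambda>i. b i \<in> Units (H i)) U \<and> \<not> eventually (\<lambda>i. c i \<in> Units (H i)) U)"
    unfolding eventually_not_ultrafilter[OF U, symmetric]
    by (simp add: eventually_disj_ultrafilter[OF U] eventually_bex_carrier eventually_conj_iff)
  also have "\<dots> \<longleftrightarrow> cls x \<in> Units M \<or> (\<exists>b\<in>Fam. \<exists>c\<in>Fam. cls x = cls b \<otimes>\<^bsub>M\<^esub> cls c \<and>
      cls b \<notin> Units M \<and> cls c \<notin> Units M)"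
    using x by (simp add: Units_M_iff mult_M cls_eq_iff mult_Fam cong: bex_cong)
  also have "\<dots> \<longleftrightarrow> \<not> irreducible M (cls x)"
    using x by (subst M.irreducible_iff_atom) (auto simp: carrier_M)
  finally show ?thesis by blast
qed

lemma associated_M_iff:
  assumes x: "x \<in> Fam" and y: "y \<in> Fam"
  shows "cls x \<sim>\<^bsub>M\<^esub> cls y \<longleftrightarrow> eventually (\<lambda>i. x i \<sim>\<^bsub>H i\<^esub> y i) U"
proof -
  \<comment> \<open>The unit is quantified over the whole carrier, with being a unit as a conjunct,
    to fit \<open>eventually_bex_carrier\<close>.\<close>
  have "x i \<sim>\<^bsub>H i\<^esub> y i \<longleftrightarrow>
      (\<exists>e\<in>carrier (H i). e \<in> Units (H i) \<and> x i = e \<otimes>\<^bsub>H i\<^esub> y i)" for i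
    using x y by (subst comm_monoid_cancel.associated_iff_unit_mult[OF H])
      (auto simp: Fam_def Units_def)
  then have "eventually (\<lambda>i. x i \<sim>\<^bsub>H i\<^esub> y i) U \<longleftrightarrow>
      (\<exists>e\<in>Fam. cls e \<in> Units M \<and> cls x = cls e \<otimes>\<^bsub>M\<^esub> cls y)"
    using x y by (simp add: eventually_bex_carrier eventually_conj_iff Units_M_iff mult_M cls_eq_iff
      mult_Fam cong: bex_cong)
  also have "\<dots> \<longleftrightarrow> cls x \<sim>\<^bsub>M\<^esub> cls y"
    using x y by (subst M.associated_iff_unit_mult) (auto simp: carrier_M Units_def)
  finally show ?thesis by simp
qed

section \<open>Transfer of factorizations and of lower bounds for their number\<close>

lemma essentially_equal_M_iff:
  assumes "set xs \<subseteq> Fam" and "set ys \<subseteq> Fam"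
  shows "essentially_equal M (map cls xs) (map cls ys) \<longleftrightarrow>
    eventually (\<lambda>i. essentially_equal (H i) (map (\<lambda>x. x i) xs) (map (\<lambda>y. y i) ys)) U"
proof (cases "length xs = length ys")
  case True
  have mem: "xs ! \<sigma> k \<in> Fam" "ys ! k \<in> Fam" "\<sigma> k < length xs"
    if "\<sigma> permutes {..<length xs}" "k < length xs" for \<sigma> k
    using assms True that permutes_in_image[of \<sigma> "{..<length xs}" k] by (auto dest: nth_mem)
  let ?S = "{\<sigma>. \<sigma> permutes {..<length xs}}"
  have "eventually (\<lambda>i. essentially_equal (H i) (map (\<lambda>x. x i) xs) (map (\<lambda>y. y i) ys)) U \<longleftrightarrow>
      eventually (\<lambda>i. \<exists>\<sigma>\<in>?S. \<forall>k\<in>{..<length xs}. (xs ! \<sigma> k) i \<sim>\<^bsub>H i\<^esub> (ys ! k) i) U"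
    unfolding essentially_equal_iff_permutation using True mem(3)
    by (intro eventually_cong always_eventually refl) auto
  \<comment> \<open>There are only finitely many permutations, so a single one works for almost all
    \<open>i\<close>.\<close>
  also have "\<dots> \<longleftrightarrow>
      (\<exists>\<sigma>\<in>?S. \<forall>k\<in>{..<length xs}. eventually (\<lambda>i. (xs ! \<sigma> k) i \<sim>\<^bsub>H i\<^esub> (ys ! k) i) U)"
    by (subst eventually_bex_ultrafilter[OF U])
      (simp_all add: finite_permutations eventually_ball_finite_distrib)
  also have "\<dots> \<longleftrightarrow> (\<exists>\<sigma>\<in>?S. \<forall>k\<in>{..<length xs}. cls (xs ! \<sigma> k) \<sim>\<^bsub>M\<^esub> cls (ys ! k))"
    using mem by (simp add: associated_M_iff)
  also have "\<dots> \<longleftrightarrow> essentially_equal M (map cls xs) (map cls ys)"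
    unfolding essentially_equal_iff_permutation using True mem(3) by auto
  finally show ?thesis by simp
next
  case False
  \<comment> \<open>The lengths do not depend on \<open>i\<close>, so both sides are false, the
    right one because \<open>U\<close> is proper.\<close>
  with U show ?thesis
    by (simp add: essentially_equal_iff_permutation ultrafilter_def)
qed

text \<open>Membership in \<open>Fam\<close> is carried through the induction because
  \<open>mult_M\<close> needs it for the product of the tail.\<close>

lemma foldr_mult_M:
  assumes "set xs \<subseteq> Fam"
  shows "(\<lambda>i. foldr (\<otimes>\<^bsub>H i\<^esub>) (map (\<lambda>x. x i) xs) \<one>\<^bsub>H i\<^esub>) \<in> Fam \<and>
    foldr (\<otimes>\<^bsub>M\<^esub>) (map cls xs) \<one>\<^bsub>M\<^esub> =
    cls (\<lambda>i. foldr (\<otimes>\<^bsub>H i\<^esub>) (map (\<lambda>x. x i) xs) \<one>\<^bsub>H i\<^esub>)"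
  using assms by (induction xs) (auto simp: one_Fam one_M mult_Fam mult_M)

text \<open>For a non-empty list the clause for units drops out, leaving a finite conjunction of an
  equation, irreducibility of the entries and a length condition independent of
  \<open>i\<close>.\<close>

lemma factorizations_M_iff:
  assumes xs: "set xs \<subseteq> Fam" "xs \<noteq> []" and a: "a \<in> Fam"
  shows "map cls xs \<in> factorizations M (cls a) l \<longleftrightarrow>
    eventually (\<lambda>i. map (\<lambda>x. x i) xs \<in> factorizations (H i) (a i) l) U"
proof -
  have ne: "U \<noteq> bot"
    using U by (simp add: ultrafilter_def)
  have irr: "(\<forall>x\<in>set xs. eventually (\<lambda>i. irreducible (H i) (x i)) U) \<longleftrightarrow>
      (\<forall>x\<in>set xs. irreducible M (cls x))"
    using xs(1) by (intro ball_cong refl) (auto simp: irreducible_M_iff)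
  have "eventually (\<lambda>i. map (\<lambda>x. x i) xs \<in> factorizations (H i) (a i) l) U \<longleftrightarrow>
    eventually (\<lambda>i. length xs = l \<and> foldr (\<otimes>\<^bsub>H i\<^esub>) (map (\<lambda>x. x i) xs) \<one>\<^bsub>H i\<^esub> = a i \<and>
      (\<forall>x\<in>set xs. irreducible (H i) (x i))) U"
    using xs by (intro eventually_cong always_eventually refl)
      (auto simp: factorizations_def factors_def Fam_def)
  also have "\<dots> \<longleftrightarrow> length xs = l \<and> foldr (\<otimes>\<^bsub>M\<^esub>) (map cls xs) \<one>\<^bsub>M\<^esub> = cls a \<and>
      (\<forall>x\<in>set xs. irreducible M (cls x))"
    using a foldr_mult_M[OF xs(1)] ne
    by (simp add: eventually_conj_iff eventually_ball_finite_distrib cls_eq_iff irr)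
  also have "\<dots> \<longleftrightarrow> map cls xs \<in> factorizations M (cls a) l"
    using xs by (auto simp: factorizations_def factors_def carrier_M)
  finally show ?thesis by simp
qed

text \<open>For fixed lists of families the claim is a finite Boolean combination of transferred
  statements; \<open>l > 0\<close> keeps the lists non-empty. It remains to lift lists over
  \<open>M\<close> to representatives and to glue lists over the \<open>H i\<close> into
  families.\<close>

lemma many_factorizations_M_iff:
  assumes a: "a \<in> Fam" and "l > 0"
  shows "many_factorizations M (cls a) l n \<longleftrightarrow>
    eventually (\<lambda>i. many_factorizations (H i) (a i) l n) U"
proof -
  have transfer: "(\<forall>k<n. map cls (F k) \<in> factorizations M (cls a) l) \<and>
      (\<forall>k<n. \<forall>k'<k. \<not> essentially_equal M (map cls (F k)) (map cls (F k'))) \<longleftrightarrow>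
      eventually (\<lambda>i. (\<forall>k<n. map (\<lambda>x. x i) (F k) \<in> factorizations (H i) (a i) l) \<and>
        (\<forall>k<n. \<forall>k'<k. \<not> essentially_equal (H i) (map (\<lambda>x. x i) (F k)) (map (\<lambda>x. x i) (F k')))) U"
    if "\<And>k. set (F k) \<subseteq> Fam \<and> length (F k) = l" for F
  proof -
    have "F k \<noteq> []" for k
      using that[of k] \<open>l > 0\<close> by auto
    then show ?thesis
      \<comment> \<open>The bounds \<open>k < n\<close> and \<open>k' < k\<close> become memberships
        in finite sets, over which \<open>eventually\<close> distributes.\<close>
      using that a unfolding Ball_def[of "{..<_}", unfolded lessThan_iff, symmetric]
      by (simp add: eventually_conj_iff eventually_ball_finite_distrib factorizations_M_iff
        essentially_equal_M_iff eventually_not_ultrafilter[OF U])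
  qed
  show ?thesis
  proof
    assume "many_factorizations M (cls a) l n"
    then obtain f where f: "\<And>k. k < n \<Longrightarrow> f k \<in> factorizations M (cls a) l"
      "\<And>k k'. k < n \<Longrightarrow> k' < k \<Longrightarrow> \<not> essentially_equal M (f k) (f k')"
      unfolding many_factorizations_def by blast
    \<comment> \<open>Lists of representatives are chosen; default lists at \<open>k \<ge> n\<close>
      give \<open>F\<close> the shape that \<open>transfer\<close> asks of all
      \<open>k\<close>.\<close>
    have "\<exists>xs. set xs \<subseteq> Fam \<and> length xs = l \<and> (k < n \<longrightarrow> map cls xs = f k)" for k
    proof (cases "k < n")
      case True
      then have "f k \<in> lists (cls ` Fam)" "length (f k) = l"
        using f(1) by (auto simp: factorizations_def carrier_M)
      then show ?thesis
        unfolding lists_image by auto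
    next
      case False
      then show ?thesis
        using one_Fam by (intro exI[of _ "replicate l (\<lambda>i. \<one>\<^bsub>H i\<^esub>)"]) auto
    qed
    then obtain F where F: "\<And>k. set (F k) \<subseteq> Fam \<and> length (F k) = l"
      "\<And>k. k < n \<Longrightarrow> map cls (F k) = f k"
      by metis
    have "(\<forall>k<n. map cls (F k) \<in> factorizations M (cls a) l) \<and>
        (\<forall>k<n. \<forall>k'<k. \<not> essentially_equal M (map cls (F k)) (map cls (F k')))"
      using f F(2) by auto
    from this[unfolded transfer[OF F(1)]]
    show "eventually (\<lambda>i. many_factorizations (H i) (a i) l n) U"
      unfolding many_factorizations_def
      by (rule eventually_mono) (rule exI)
  next
    assume ev: "eventually (\<lambda>i. many_factorizations (H i) (a i) l n) U"
    \<comment> \<open>Constant lists fill in for \<open>k \<ge> n\<close> and for those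
      \<open>i\<close> with too few factorizations, so that every list has length
      \<open>l\<close>.\<close>
    have "\<exists>f. (\<forall>k. set (f k) \<subseteq> carrier (H i) \<and> length (f k) = l) \<and>
        (many_factorizations (H i) (a i) l n \<longrightarrow>
          (\<forall>k<n. f k \<in> factorizations (H i) (a i) l) \<and>
          (\<forall>k<n. \<forall>k'<k. \<not> essentially_equal (H i) (f k) (f k')))" for i
    proof (cases "many_factorizations (H i) (a i) l n")
      case True
      then obtain f where "\<forall>k<n. f k \<in> factorizations (H i) (a i) l"
        "\<forall>k<n. \<forall>k'<k. \<not> essentially_equal (H i) (f k) (f k')"
        unfolding many_factorizations_def by blast
      then show ?thesis
        using monoid.one_closed[OF monoid_H[of i]]
        by (intro exI[of _ "\<lambda>k. if k < n then f k else replicate l \<one>\<^bsub>H i\<^esub>"])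
          (auto simp: factorizations_def)
    next
      case False
      then show ?thesis
        using monoid.one_closed[OF monoid_H[of i]]
        by (intro exI[of _ "\<lambda>k. replicate l \<one>\<^bsub>H i\<^esub>"]) auto
    qed
    then obtain f where f: "\<And>i k. set (f i k) \<subseteq> carrier (H i)" "\<And>i k. length (f i k) = l"
      "\<And>i. many_factorizations (H i) (a i) l n \<Longrightarrow>
          (\<forall>k<n. f i k \<in> factorizations (H i) (a i) l) \<and>
          (\<forall>k<n. \<forall>k'<k. \<not> essentially_equal (H i) (f i k) (f i k'))"
      by metis
    \<comment> \<open>Gluing by transposition: the \<open>j\<close>-th entry of \<open>F k\<close>
      is the family of \<open>j\<close>-th entries of the lists \<open>f i k\<close>.\<close>
    define F where "F k = map (\<lambda>j i. f i k ! j) [0..<l]" for k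
    have F: "set (F k) \<subseteq> Fam \<and> length (F k) = l" for k
      using f(1,2) by (auto simp: F_def Fam_def intro!: subsetD[OF f(1)] nth_mem)
    have Ff: "map (\<lambda>x. x i) (F k) = f i k" for i k
      using f(2)[of i k] map_nth[of "f i k"] by (simp add: F_def comp_def)
    have "(\<forall>k<n. map cls (F k) \<in> factorizations M (cls a) l) \<and>
        (\<forall>k<n. \<forall>k'<k. \<not> essentially_equal M (map cls (F k)) (map cls (F k')))"
      unfolding transfer[OF F] Ff using ev by (rule eventually_mono) (rule f(3))
    then show "many_factorizations M (cls a) l n"
      unfolding many_factorizations_def by (rule exI[of _ "\<lambda>k. map cls (F k)"])
  qed
qed

end

section \<open>Realizing multisets of lengths\<close>

theorem theorem2:
  fixes H :: "nat \<Rightarrow> ('a, 'b) monoid_scheme"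
    and U :: "nat filter"
    and L :: "'k cmultiset"
  assumes "\<And>i. comm_monoid_cancel (H i)"
    and "\<And>i (K :: nat cmultiset). multiset_ge2 K \<Longrightarrow> finite_cmultiset K \<Longrightarrow>
           \<exists>a\<in>carrier (H i). \<forall>l. multiset_of_lengths (H i) a l =o K l"
    and "ultrafilter U" and "nonprincipal U"
    and "multiset_ge2 L"
  shows "\<exists>r\<in>carrier (ultraproduct U H). \<forall>l\<ge>2.
           (\<not> cinfinite (L l) \<longrightarrow> multiset_of_lengths (ultraproduct U H) r l =o L l) \<and>
           (cinfinite (multiset_of_lengths (ultraproduct U H) r l) \<longleftrightarrow> cinfinite (L l))"
proof -
  interpret ultraproduct_monoids U H
    using assms(1,3) by (intro ultraproduct_monoids.intro)
  \<comment> \<open>Multiplicities are read off from \<open>Field (L l)\<close>, as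
    \<open>L l\<close> is a cardinal order. The cutoff at \<open>i\<close> leaves finitely many
    lengths.\<close>
  define m where "m i l = (if 2 \<le> l \<and> l \<le> i then
      if finite (Field (L l)) then card (Field (L l)) else i else 0)" for i l
  have "\<exists>a\<in>carrier (H i). \<forall>l. multiset_of_lengths (H i) a l =o |{..<m i l}|" for i
  proof (rule assms(2))
    show "multiset_ge2 (\<lambda>l. |{..<m i l}| )"
      by (auto simp: multiset_ge2_def m_def czero_def card_of_Card_order card_of_empty_ordIso)
    have "{l. \<not> |{..<m i l}| =o (czero :: nat rel)} \<subseteq> {..i}"
      by (auto simp: m_def czero_def card_of_empty_ordIso split: if_splits)
    then show "finite_cmultiset (\<lambda>l. |{..<m i l}| )"
      by (auto simp: finite_cmultiset_def cinfinite_def Field_card_of intro: finite_subset)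
  qed
  then obtain a where a: "a i \<in> carrier (H i)"
    "|factorizations (H i) (a i) l // ess_same (H i) (a i) l| =o |{..<m i l}|" for i l
    unfolding multiset_of_lengths_def by metis
  have many_a: "many_factorizations (H i) (a i) l n \<longleftrightarrow> n \<le> m i l" for i l n
  proof -
    from a(2) obtain h where
      "bij_betw h (factorizations (H i) (a i) l // ess_same (H i) (a i) l) {..<m i l}"
      using card_of_ordIso by blast
    then show ?thesis
      by (simp add: comm_monoid_cancel.many_factorizations_iff[OF assms(1)]
        bij_betw_finite bij_betw_same_card)
  qed
  have a_Fam: "a \<in> Fam"
    using a(1) by (simp add: Fam_def)
  define Q where "Q l = factorizations M (cls a) l // ess_same M (cls a) l" for l
  \<comment> \<open>All lower bounds on the number of classes in \<open>Q l\<close> are now decided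
    by the numbers \<open>m i l\<close> for almost all \<open>i\<close>.\<close>
  have many: "infinite (Q l) \<or> n \<le> card (Q l) \<longleftrightarrow> eventually (\<lambda>i. n \<le> m i l) U" if "l \<ge> 2" for l n
    using many_factorizations_M_iff[OF a_Fam, of l n] that
    by (simp add: M.many_factorizations_iff Q_def many_a)
  have ne: "U \<noteq> bot"
    using assms(3) by (simp add: ultrafilter_def)
  have fin: "finite (Q l) \<and> card (Q l) = card (Field (L l))"
    if l: "l \<ge> 2" and f: "finite (Field (L l))" for l
  proof -
    \<comment> \<open>From index \<open>l\<close> on the cutoff no longer affects length
      \<open>l\<close>.\<close>
    have "eventually (\<lambda>i. m i l = card (Field (L l))) U"
      using eventually_ge_nonprincipal[OF assms(3,4), of l]
      by (rule eventually_mono) (simp add: m_def l f)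
    then have "eventually (\<lambda>i. n \<le> m i l) U \<longleftrightarrow> eventually (\<lambda>i. n \<le> card (Field (L l))) U" for n
      by (rule eventually_cong) simp
    then have "infinite (Q l) \<or> n \<le> card (Q l) \<longleftrightarrow> n \<le> card (Field (L l))" for n
      using many[OF l, of n] ne by simp
    \<comment> \<open>The instance at the successor forces \<open>Q l\<close> to be finite; the
      other two then give both inequalities between the counts.\<close>
    from this[of "card (Q l)"] this[of "Suc (card (Field (L l)))"] this[of "card (Field (L l))"]
    show ?thesis by auto
  qed
  have inf: "infinite (Q l)" if l: "l \<ge> 2" and f: "infinite (Field (L l))" for l
  proof
    assume "finite (Q l)"
    \<comment> \<open>Here \<open>m i l = i\<close> for \<open>i \<ge> l\<close>, which eventually
      exceeds the supposed finite \<open>card (Q l)\<close>.\<close>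
    moreover have "eventually (\<lambda>i. Suc (card (Q l)) \<le> m i l) U"
      using eventually_ge_nonprincipal[OF assms(3,4), of "max l (Suc (card (Q l)))"] l f
      by (auto simp: m_def elim!: eventually_mono)
    ultimately show False
      using many[OF l, of "Suc (card (Q l))"] by simp
  qed
  show ?thesis
  proof (intro bexI[of _ "cls a"] allI impI conjI)
    show "cls a \<in> carrier M"
      using a_Fam by (simp add: carrier_M)
  next
    fix l :: nat assume l: "2 \<le> l" and "\<not> cinfinite (L l)"
    then have f: "finite (Field (L l))"
      by (simp add: cinfinite_def)
    with fin[OF l f] have "\<exists>h. bij_betw h (Q l) (Field (L l))"
      by (simp add: bij_betw_iff_card)
    then have "|Q l| =o |Field (L l)|"
      by (simp add: card_of_ordIso)
    also have "|Field (L l)| =o L l"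
      using assms(5) by (simp add: multiset_ge2_def card_of_Field_ordIso)
    finally show "multiset_of_lengths M (cls a) l =o L l"
      by (simp add: multiset_of_lengths_def Q_def)
  next
    fix l :: nat assume l: "2 \<le> l"
    show "cinfinite (multiset_of_lengths M (cls a) l) \<longleftrightarrow> cinfinite (L l)"
      using fin[OF l] inf[OF l]
      by (auto simp: multiset_of_lengths_def cinfinite_def Field_card_of Q_def)
  qed
qed

end
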